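(* There exists a numerical semigroup $S$ that is $+ + -$ avoiding and has matricial dimension greater than $2$. In particular, it is false that every numerical semigroup all of whose nonzero small elements are lonely is dimension-$2$ realizable.
   Context: $\mathbb{N}=\{0,1,2,\ldots\}$. A numerical semigroup is an additive submonoid of $\mathbb{N}$ with finite complement; its Frobenius number $g(S)$ is the largest integer not in $S$, and its nonzero small elements are the $n\in S\setminus\{0\}$ with $n<g(S)$. Such an $n$ is lonely if $n-1\notin S$ and $n+1\notin S$. $S$ is $+ + -$ avoiding if $n,n+1\in S$ implies $n+2\in S$. For $A\in\mathrm{M}_d(\mathbb{Q})$, $\mathcal{S}(A)=\{n\in\mathbb{N}: A^n\in\mathrm{M}_d(\mathbb{Z})\}$. The matricial dimension of $S$ is the least $d\geq 1$ with $S=\mathcal{S}(A)$ for some $A\in\mathrm{M}_d(\mathbb{Q})$; $S$ is dimension-$2$ realizable iff its matricial dimension is at most $2$. *)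

theory Defs
  imports Complex_Main "Jordan_Normal_Form.Matrix"
begin

definition numerical_semigroup :: "nat set \<Rightarrow> bool" where
  "numerical_semigroup S \<longleftrightarrow> 0 \<in> S \<and> (\<forall>a\<in>S. \<forall>b\<in>S. a + b \<in> S) \<and> finite (- S)"

(* The largest integer, not the largest natural number: for S = UNIV the value is -1. *)
definition frobenius_number :: "nat set \<Rightarrow> int" where
  "frobenius_number S = (GREATEST z. z \<notin> int ` S)"

definition nonzero_small_elements :: "nat set \<Rightarrow> nat set" where
  "nonzero_small_elements S = {n \<in> S. n \<noteq> 0 \<and> int n < frobenius_number S}"

(* Only meant for n > 0, so the natural-number subtraction does not truncate. *)
definition lonely :: "nat set \<Rightarrow> nat \<Rightarrow> bool" where
  "lonely S n \<longleftrightarrow> n - 1 \<notin> S \<and> n + 1 \<notin> S"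

definition ppm_avoiding :: "nat set \<Rightarrow> bool" where
  "ppm_avoiding S \<longleftrightarrow> (\<forall>n. n \<in> S \<and> n + 1 \<in> S \<longrightarrow> n + 2 \<in> S)"

definition integral_exponents :: "rat mat \<Rightarrow> nat set" where
  "integral_exponents A = {n. elements_mat (A ^\<^sub>m n) \<subseteq> \<int>}"

(* The least d is taken over a nonempty set for every numerical semigroup S: let m be the
   least number beyond which everything lies in S, put w i = 1 if i is in S and w i = 1/2
   otherwise, and let A be the nilpotent weighted shift of size max m 1 that sends e_i to
   (w (i+1) / w i) e_(i+1). Then the integral exponents of A are exactly S. *)
definition matricial_dimension :: "nat set \<Rightarrow> nat" where
  "matricial_dimension S =
     (LEAST d. d \<ge> 1 \<and> (\<exists>A \<in> carrier_mat d d. S = integral_exponents A))"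

definition dim2_realizable :: "nat set \<Rightarrow> bool" where
  "dim2_realizable S \<longleftrightarrow> matricial_dimension S \<le> 2"

end

theory Submission
  imports Defs "HOL-Computational_Algebra.Polynomial"
begin

text \<open>
  Let \<open>A\<close> be a rational \<open>2 \<times> 2\<close> matrix with trace \<open>t\<close> and determinant \<open>d\<close> such that
  \<open>A\<^sup>5\<close> is integral. Then \<open>t\<close> and \<open>d\<close> are integers. By Cayley--Hamilton the off-diagonal
  entries of \<open>A\<^sup>n\<close> are of the form \<open>y U\<^sub>n\<close> with \<open>U\<^sub>0 = 0\<close>, \<open>U\<^sub>1 = 1\<close>,
  \<open>U\<^sub>n\<^sub>+\<^sub>2 = t U\<^sub>n\<^sub>+\<^sub>1 - d U\<^sub>n\<close>. If they are integers, then \<open>A\<^sup>n\<close> is integral, because its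
  diagonal entries have an integral sum and an integral product. The identity
  \<open>(d U\<^sub>6)\<^sup>2 = U\<^sub>5 (t U\<^sub>6) (t\<^sup>4 - 4 t\<^sup>2 d + 3 d\<^sup>2) + (3 d - t\<^sup>2) (t U\<^sub>6)\<^sup>2\<close>
  shows that if \<open>y U\<^sub>5\<close> and \<open>y U\<^sub>7 = y t U\<^sub>6 - y d U\<^sub>5\<close> are integers, then so is
  \<open>y d U\<^sub>6\<close>, hence so is \<open>y U\<^sub>8 = t (y U\<^sub>7) - y d U\<^sub>6\<close>. So \<open>5\<close> and \<open>7\<close> in \<open>\<S>(A)\<close> force
  \<open>8\<close> in \<open>\<S>(A)\<close>, and the semigroup \<open>{0, 5, 7, 9, 10, \<dots>}\<close> needs dimension at least \<open>3\<close>.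
\<close>

section \<open>Integrality criteria for rational numbers\<close>

lemma rat_root_of_monic_int:
  fixes x :: rat
  assumes "lead_coeff p = 1" and "\<And>i. coeff p i \<in> \<int>" and "poly p x = 0"
  shows "x \<in> \<int>"
proof (rule rational_algebraic_int_is_int)
  show "algebraic_int x"
    by (rule algebraic_int.intros[OF assms(1) _ assms(3)]) (simp add: assms(2))
  obtain a b where "quotient_of x = (a, b)"
    by (cases "quotient_of x")
  then have "x = of_int a / of_int b"
    by (rule quotient_of_div)
  then show "x \<in> \<rat>"
    by simp
qed

lemma Ints_pCons_coeff:
  assumes "a \<in> \<int>" and "\<And>i. coeff p i \<in> \<int>"
  shows "coeff (pCons a p) i \<in> \<int>"
  using assms by (cases i) auto

lemma Ints_if_power_Ints:
  fixes x :: rat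
  assumes "x ^ n \<in> \<int>" and "n > 0"
  shows "x \<in> \<int>"
proof (rule rat_root_of_monic_int)
  let ?p = "monom 1 n + [:- (x ^ n):]"
  have "degree ?p = n"
    using assms(2) by (subst degree_add_eq_left) (auto simp: degree_monom_eq)
  then show "lead_coeff ?p = 1"
    using assms(2) by (simp add: coeff_pCons split: nat.split)
  show "coeff ?p i \<in> \<int>" for i
    using assms(1) by (auto simp: coeff_pCons split: nat.split)
  show "poly ?p x = 0"
    by (simp add: poly_monom)
qed

lemma Ints_if_sum_prod_Ints:
  fixes x y :: rat
  assumes "x + y \<in> \<int>" and "x * y \<in> \<int>"
  shows "x \<in> \<int>"
proof (rule rat_root_of_monic_int)
  let ?p = "[:x * y, - (x + y), 1:]"
  show "coeff ?p i \<in> \<int>" for i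
    using assms by (intro Ints_pCons_coeff) (auto simp del: minus_add_distrib)
qed (simp_all add: algebra_simps)

text \<open>Writing \<open>t = a + b\<close> and \<open>d = a * b\<close>, the quintic expression is
  \<open>a ^ 5 + b ^ 5\<close>. Taking its value as the constant term makes \<open>t\<close> a root
  of a monic quintic with integer coefficients.\<close>

lemma Ints_if_quintic_trace_Ints:
  fixes t d :: rat
  assumes "t ^ 5 - 5 * t ^ 3 * d + 5 * t * d\<^sup>2 \<in> \<int>" and "d \<in> \<int>"
  shows "t \<in> \<int>"
proof (rule rat_root_of_monic_int)
  let ?p = "[:- (t ^ 5 - 5 * t ^ 3 * d + 5 * t * d\<^sup>2), 5 * d\<^sup>2, 0, - (5 * d), 0, 1:]"
  show "coeff ?p i \<in> \<int>" for i
    using assms by (intro Ints_pCons_coeff) (auto simp del: minus_diff_eq minus_add_distrib)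
qed (simp_all add: algebra_simps power2_eq_square eval_nat_numeral)

text \<open>The factor \<open>e 1\<close> need not be an integer, so integrality of the Lucas
  numbers themselves does not help. Instead \<open>(d * e 6)\<^sup>2\<close> is built from products
  of two integral quantities, \<open>e 5\<close> and \<open>t * e 6\<close>.\<close>

lemma lucas_sequence_8_Ints:
  fixes e :: "nat \<Rightarrow> rat"
  assumes zero: "e 0 = 0" and rec: "\<And>n. e (n + 2) = t * e (n + 1) - d * e n"
    and t: "t \<in> \<int>" and d: "d \<in> \<int>" and e5: "e 5 \<in> \<int>" and e7: "e 7 \<in> \<int>"
  shows "e 8 \<in> \<int>"
proof -
  define y where "y = e 1"
  have r: "e 2 = t * e 1 - d * e 0" "e 3 = t * e 2 - d * e 1" "e 4 = t * e 3 - d * e 2"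
    "e 5 = t * e 4 - d * e 3" "e 6 = t * e 5 - d * e 4" "e 7 = t * e 6 - d * e 5"
    "e 8 = t * e 7 - d * e 6"
    using rec by (simp_all add: eval_nat_numeral)
  have e2: "e 2 = y * t"
    using zero by (simp add: r(1) y_def)
  have e3: "e 3 = y * (t\<^sup>2 - d)"
    by (simp add: r(2) e2 y_def algebra_simps power2_eq_square)
  have e4: "e 4 = y * (t ^ 3 - 2 * t * d)"
    by (simp add: r(3) e2 e3 algebra_simps power2_eq_square power3_eq_cube)
  \<comment> \<open>Here \<open>u\<close> is the Lucas number with index 5, and \<open>t * v\<close>
    is the one with index 6.\<close>
  define u where "u = t ^ 4 - 3 * t\<^sup>2 * d + d\<^sup>2"
  define v where "v = t ^ 4 - 4 * t\<^sup>2 * d + 3 * d\<^sup>2"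
  have e5': "e 5 = y * u"
    by (simp add: r(4) e3 e4 u_def algebra_simps power2_eq_square power3_eq_cube power4_eq_xxxx)
  have e6: "e 6 = y * t * v"
    by (simp add: r(5) e4 e5' u_def v_def algebra_simps power2_eq_square power3_eq_cube power4_eq_xxxx)
  have te6: "t * e 6 \<in> \<int>"
    using Ints_add[OF e7 Ints_mult[OF d e5]] by (simp add: r(6))
  have "d\<^sup>2 = u + (3 * d - t\<^sup>2) * t\<^sup>2"
    by (simp add: u_def algebra_simps power2_eq_square power4_eq_xxxx)
  then have "(d * e 6)\<^sup>2 = (u + (3 * d - t\<^sup>2) * t\<^sup>2) * (e 6)\<^sup>2"
    by (simp only: power_mult_distrib)
  \<comment> \<open>In \<open>u * (e 6)\<^sup>2\<close> one factor \<open>e 6 = y * t * v\<close>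
    gives \<open>y\<close> to \<open>u\<close> and \<open>t\<close> to the other
    \<open>e 6\<close>.\<close>
  also have "\<dots> = e 5 * (t * e 6) * v + (3 * d - t\<^sup>2) * (t * e 6)\<^sup>2"
    by (simp add: e5' e6 algebra_simps power2_eq_square)
  also have "\<dots> \<in> \<int>"
  proof (rule Ints_add[OF Ints_mult[OF Ints_mult[OF e5 te6]] Ints_mult[OF _ Ints_power[OF te6]]])
    show "v \<in> \<int>" and "3 * d - t\<^sup>2 \<in> \<int>"
      using t d by (simp_all add: v_def)
  qed
  finally have "d * e 6 \<in> \<int>"
    by (rule Ints_if_power_Ints) simp
  then show ?thesis
    unfolding r(7) using t e7 by auto
qed

section \<open>Integral powers of matrices of size at most 2\<close>

lemma mem_integral_exponents_iff:
  assumes "A \<in> carrier_mat n n"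
  shows "k \<in> integral_exponents A \<longleftrightarrow> (\<forall>i<n. \<forall>j<n. (A ^\<^sub>m k) $$ (i, j) \<in> \<int>)"
proof -
  have "A ^\<^sub>m k \<in> carrier_mat n n"
    using assms by simp
  then show ?thesis
    unfolding integral_exponents_def mem_Collect_eq subset_iff
    by (metis elements_matD elements_matI carrier_matD)
qed

lemma pow_mat_2_Suc_index:
  fixes A :: "'a :: comm_ring_1 mat"
  assumes A: "A \<in> carrier_mat 2 2" and "i < 2" and "j < 2"
  shows "(A ^\<^sub>m Suc n) $$ (i, j) = (A ^\<^sub>m n) $$ (i, 0) * A $$ (0, j) + (A ^\<^sub>m n) $$ (i, 1) * A $$ (1, j)"
proof -
  have "(A ^\<^sub>m n) \<in> carrier_mat 2 2"
    using A by simp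
  then show ?thesis
    using assms by (simp add: scalar_prod_def numeral_2_eq_2)
qed

text \<open>Row \<open>i\<close> of the powers evolves by right multiplication with
  \<open>A\<close>, so expanding two such steps suffices.\<close>

lemma pow_mat_2_cayley_hamilton:
  fixes A :: "'a :: comm_ring_1 mat"
  assumes A: "A \<in> carrier_mat 2 2" and i: "i < 2" and j: "j < 2"
  shows "(A ^\<^sub>m (n + 2)) $$ (i, j) = (A $$ (0, 0) + A $$ (1, 1)) * (A ^\<^sub>m (n + 1)) $$ (i, j)
    - (A $$ (0, 0) * A $$ (1, 1) - A $$ (0, 1) * A $$ (1, 0)) * (A ^\<^sub>m n) $$ (i, j)"
proof -
  define e where "e n j = (A ^\<^sub>m n) $$ (i, j)" for n j
  define a where "a i j = A $$ (i, j)" for i j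
  have step: "e (Suc n) 0 = e n 0 * a 0 0 + e n 1 * a 1 0" "e (Suc n) 1 = e n 0 * a 0 1 + e n 1 * a 1 1" for n
    using pow_mat_2_Suc_index[OF A i, of 0 n] pow_mat_2_Suc_index[OF A i, of 1 n]
    unfolding e_def a_def by simp_all
  have "e (n + 2) j = (a 0 0 + a 1 1) * e (n + 1) j - (a 0 0 * a 1 1 - a 0 1 * a 1 0) * e n j"
    if "j = 0 \<or> j = 1" for j
    using that step[of n] step[of "Suc n"] by (elim disjE) (simp_all add: algebra_simps)
  moreover have "j = 0 \<or> j = 1"
    using j by auto
  ultimately show ?thesis
    unfolding e_def a_def by blast
qed

lemma pow_mat_2_det:
  fixes A :: "'a :: comm_ring_1 mat"
  assumes A: "A \<in> carrier_mat 2 2"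
  shows "(A ^\<^sub>m n) $$ (0, 0) * (A ^\<^sub>m n) $$ (1, 1) - (A ^\<^sub>m n) $$ (0, 1) * (A ^\<^sub>m n) $$ (1, 0)
    = (A $$ (0, 0) * A $$ (1, 1) - A $$ (0, 1) * A $$ (1, 0)) ^ n"
proof (induction n)
  case 0
  then show ?case using A by simp
next
  case (Suc n)
  define e where "e i j = (A ^\<^sub>m n) $$ (i, j)" for i j
  have step: "(A ^\<^sub>m Suc n) $$ (i, j) = e i 0 * A $$ (0, j) + e i 1 * A $$ (1, j)" if "i < 2" "j < 2" for i j
    using pow_mat_2_Suc_index[OF A that] by (simp only: e_def)
  have "(A ^\<^sub>m Suc n) $$ (0, 0) * (A ^\<^sub>m Suc n) $$ (1, 1) - (A ^\<^sub>m Suc n) $$ (0, 1) * (A ^\<^sub>m Suc n) $$ (1, 0)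
    = (e 0 0 * e 1 1 - e 0 1 * e 1 0) * (A $$ (0, 0) * A $$ (1, 1) - A $$ (0, 1) * A $$ (1, 0))"
    using step[of 0 0] step[of 0 1] step[of 1 0] step[of 1 1]
    by (simp only: one_less_numeral_iff zero_less_numeral semiring_norm) (simp only: algebra_simps)
  then show ?case
    using Suc by (simp only: e_def power_Suc2)
qed

lemma integral_exponents_2_closed:
  assumes A: "A \<in> carrier_mat 2 2"
    and 5: "5 \<in> integral_exponents A" and 7: "7 \<in> integral_exponents A"
  shows "8 \<in> integral_exponents A"
proof -
  define t where "t = A $$ (0, 0) + A $$ (1, 1)"
  define d where "d = A $$ (0, 0) * A $$ (1, 1) - A $$ (0, 1) * A $$ (1, 0)"
  define f where "f n = (\<lambda>i j. (A ^\<^sub>m n) $$ (i, j))" for n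
  define T where "T n = f n 0 0 + f n 1 1" for n
  have f0: "f 0 0 1 = 0" "f 0 1 0 = 0" "f 0 0 0 = 1" "f 0 1 1 = 1"
    using A by (auto simp: f_def)
  have f5: "f 5 i j \<in> \<int>" and f7: "f 7 i j \<in> \<int>" if "i < 2" "j < 2" for i j
    using 5 7 that by (auto simp: f_def mem_integral_exponents_iff[OF A])
  have rec: "f (n + 2) i j = t * f (n + 1) i j - d * f n i j" if "i < 2" "j < 2" for n i j
    using pow_mat_2_cayley_hamilton[OF A that] by (simp only: f_def t_def d_def)
  have det: "f n 0 0 * f n 1 1 - f n 0 1 * f n 1 0 = d ^ n" for n
    using pow_mat_2_det[OF A] by (simp only: f_def d_def)
  have "d ^ 5 \<in> \<int>"
    unfolding det[symmetric] by (intro Ints_diff Ints_mult f5) simp_all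
  then have d: "d \<in> \<int>"
    by (rule Ints_if_power_Ints) simp
  have T0: "T 0 = 2"
    by (simp add: T_def f0 f0[unfolded One_nat_def])
  have T1: "T 1 = t"
    using A by (simp add: T_def f_def t_def)
  have Trec: "T (n + 2) = t * T (n + 1) - d * T n" for n
    using rec[of 0 0 n] rec[of 1 1 n] by (simp add: T_def algebra_simps)
  have Tr: "T 2 = t * T 1 - d * T 0" "T 3 = t * T 2 - d * T 1" "T 4 = t * T 3 - d * T 2"
    "T 5 = t * T 4 - d * T 3"
    using Trec by (simp_all add: eval_nat_numeral)
  have T2: "T 2 = t\<^sup>2 - 2 * d"
    using T0 T1 by (simp add: Tr(1) power2_eq_square)
  have T3: "T 3 = t ^ 3 - 3 * t * d"
    using T1 by (simp add: Tr(2) T2 algebra_simps power2_eq_square power3_eq_cube)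
  have T4: "T 4 = t ^ 4 - 4 * t\<^sup>2 * d + 2 * d\<^sup>2"
    by (simp add: Tr(3) T2 T3 algebra_simps power2_eq_square power3_eq_cube power4_eq_xxxx)
  have t5: "t ^ 5 = t * t ^ 4"
    by (simp flip: power_Suc)
  have T5: "T 5 = t ^ 5 - 5 * t ^ 3 * d + 5 * t * d\<^sup>2"
    by (simp add: Tr(4) T3 T4 algebra_simps power2_eq_square power3_eq_cube power4_eq_xxxx t5)
  have "T 5 \<in> \<int>"
    unfolding T_def by (intro Ints_add f5) simp_all
  then have t: "t \<in> \<int>"
    unfolding T5 using d by (rule Ints_if_quintic_trace_Ints)
  \<comment> \<open>Used for the trace of the eighth power.\<close>
  have T_Ints: "T n \<in> \<int>" for n
  proof (induction n rule: induct_nat_012)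
    case (ge2 n)
    then show ?case
      using Trec[of n] t d by simp
  qed (use T0 T1 t in simp_all)
  \<comment> \<open>Only the off-diagonal sequences start at 0, as the lemma on Lucas sequences
    demands. The diagonal ones start at 1 and are recovered from trace and determinant.\<close>
  have b: "f 8 0 1 \<in> \<int>"
    by (rule lucas_sequence_8_Ints[where e = "\<lambda>n. f n 0 1", OF f0(1) rec t d f5 f7]) simp_all
  have c: "f 8 1 0 \<in> \<int>"
    by (rule lucas_sequence_8_Ints[where e = "\<lambda>n. f n 1 0", OF f0(2) rec t d f5 f7]) simp_all
  have sum: "f 8 0 0 + f 8 1 1 \<in> \<int>"
    using T_Ints[of 8] by (simp add: T_def)
  have "f 8 0 0 * f 8 1 1 = d ^ 8 + f 8 0 1 * f 8 1 0"
    using det[of 8] by (simp add: algebra_simps)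
  then have prod: "f 8 0 0 * f 8 1 1 \<in> \<int>"
    using b c d by simp
  have a: "f 8 0 0 \<in> \<int>"
    using sum prod by (rule Ints_if_sum_prod_Ints)
  then have s: "f 8 1 1 \<in> \<int>"
    using Ints_diff[OF sum a] by simp
  show ?thesis
    using a b c s unfolding mem_integral_exponents_iff[OF A] f_def by (auto simp: less_2_cases_iff)
qed

text \<open>This excludes dimension 1: a rational with an integral positive power is itself an
  integer.\<close>

lemma integral_exponents_1_closed:
  assumes A: "A \<in> carrier_mat 1 1" and n: "n \<in> integral_exponents A" "n > 0"
  shows "k \<in> integral_exponents A"
proof -
  have pow: "(A ^\<^sub>m k) $$ (0, 0) = (A $$ (0, 0)) ^ k" for k
  proof (induction k)
    case (Suc k)
    have "A ^\<^sub>m k \<in> carrier_mat 1 1"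
      using A by simp
    then show ?case
      using A Suc by (simp add: scalar_prod_def)
  qed (use A in simp)
  have "A $$ (0, 0) ^ n \<in> \<int>"
    using n(1) by (simp add: mem_integral_exponents_iff[OF A] pow)
  then have "A $$ (0, 0) \<in> \<int>"
    using n(2) by (rule Ints_if_power_Ints)
  then show ?thesis
    by (simp add: mem_integral_exponents_iff[OF A] pow)
qed

section \<open>Realizability by weighted shifts\<close>

lemma weighted_shift_pow:
  fixes w :: "nat \<Rightarrow> 'a :: field"
  assumes w: "\<And>i. w i \<noteq> 0"
    and A: "A = mat m m (\<lambda>(i, j). if i = Suc j then w i / w j else 0)"
    and "i < m" and "j < m"
  shows "(A ^\<^sub>m n) $$ (i, j) = (if i = j + n then w i / w j else 0)"
  using assms(3,4)
proof (induction n arbitrary: i j)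
  case 0
  then show ?case
    using w by (simp add: A)
next
  case (Suc n)
  have AC: "A \<in> carrier_mat m m" "A ^\<^sub>m n \<in> carrier_mat m m"
    by (simp_all add: A)
  have "(A ^\<^sub>m Suc n) $$ (i, j) = (\<Sum>k<m. (A ^\<^sub>m n) $$ (i, k) * A $$ (k, j))"
    using AC Suc.prems by (simp add: scalar_prod_def atLeast0LessThan)
  \<comment> \<open>Only \<open>k = Suc j\<close> contributes, and there the ratios of weights
    telescope.\<close>
  also have "\<dots> = (\<Sum>k<m. if k = Suc j then (if i = k + n then w i / w k else 0) * (w k / w j) else 0)"
    using Suc by (intro sum.cong) (auto simp: A)
  also have "\<dots> = (if i = j + Suc n then w i / w j else 0)"
    using Suc.prems w by (auto simp: sum.delta)
  finally show ?case .
qed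

text \<open>Ensures that the \<open>LEAST\<close> in \<open>matricial_dimension\<close> is attained.
  A ratio \<open>w (j + n) / w j\<close> fails to be integral exactly when \<open>j\<close> is in
  \<open>S\<close> and \<open>j + n\<close> is not; closure under addition forbids this for
  \<open>n\<close> in \<open>S\<close>, and \<open>j = 0\<close> exhibits it for a gap
  \<open>n\<close>.\<close>

lemma numerical_semigroup_realizable:
  assumes S: "numerical_semigroup S"
  shows "\<exists>d\<ge>1. \<exists>A\<in>carrier_mat d d. S = integral_exponents A"
proof -
  define w :: "nat \<Rightarrow> rat" where "w i = (if i \<in> S then 1 else 1 / 2)" for i
  have zero: "0 \<in> S" and add: "\<And>a b. a \<in> S \<Longrightarrow> b \<in> S \<Longrightarrow> a + b \<in> S" and fin: "finite (- S)"
    using S by (auto simp: numerical_semigroup_def)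
  obtain m where m: "\<And>n. n \<notin> S \<Longrightarrow> n < m"
    using fin by (metis ComplI finite_nat_set_iff_bounded)
  \<comment> \<open>The size \<open>Suc m\<close> stays positive even if \<open>m = 0\<close>, and
    every gap \<open>n\<close> has an entry \<open>(n, 0)\<close>.\<close>
  define A where "A = mat (Suc m) (Suc m) (\<lambda>(i, j). if i = Suc j then w i / w j else 0)"
  have A: "A \<in> carrier_mat (Suc m) (Suc m)"
    by (simp add: A_def)
  have pow: "(A ^\<^sub>m n) $$ (i, j) = (if i = j + n then w i / w j else 0)" if "i < Suc m" "j < Suc m" for i j n
    by (rule weighted_shift_pow[OF _ A_def that]) (simp add: w_def)
  have half: "(1 / 2 :: rat) \<notin> \<int>"
  proof
    assume "(1 / 2 :: rat) \<in> \<int>"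
    then obtain k where "1 / 2 = rat_of_int k"
      by (elim Ints_cases)
    then have "rat_of_int (2 * k) = rat_of_int 1"
      by simp
    then show False
      unfolding of_int_eq_iff by presburger
  qed
  have "n \<in> S \<longleftrightarrow> n \<in> integral_exponents A" for n
  proof
    assume "n \<in> S"
    then show "n \<in> integral_exponents A"
      using add by (auto simp: mem_integral_exponents_iff[OF A] pow w_def)
  next
    assume n: "n \<in> integral_exponents A"
    show "n \<in> S"
    proof (rule ccontr)
      assume "n \<notin> S"
      then have "(A ^\<^sub>m n) $$ (n, 0) = 1 / 2"
        using m[of n] zero by (simp add: pow w_def)
      then show False
        using n m[OF \<open>n \<notin> S\<close>] half by (metis A mem_integral_exponents_iff less_Suc_eq zero_less_Suc)
    qed
  qed
  then show ?thesis
    using A by (intro exI[of _ "Suc m"]) auto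
qed

section \<open>The lower bound and the example\<close>

lemma matricial_dimension_realized:
  assumes "numerical_semigroup S"
  shows "matricial_dimension S \<ge> 1"
    and "\<exists>A\<in>carrier_mat (matricial_dimension S) (matricial_dimension S). S = integral_exponents A"
  using LeastI_ex[OF numerical_semigroup_realizable[OF assms]]
  unfolding matricial_dimension_def by auto

lemma matricial_dimension_gt_2:
  assumes S: "numerical_semigroup S" and "5 \<in> S" and "7 \<in> S" and "8 \<notin> S"
  shows "matricial_dimension S > 2"
proof (rule ccontr)
  assume "\<not> matricial_dimension S > 2"
  then have "matricial_dimension S = 1 \<or> matricial_dimension S = 2"
    using matricial_dimension_realized(1)[OF S] by auto
  then show False
    using matricial_dimension_realized(2)[OF S] assms(2-4)
      integral_exponents_1_closed[of _ 5 8] integral_exponents_2_closed by auto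
qed

theorem theorem7p4:
  "(\<exists>S. numerical_semigroup S \<and> ppm_avoiding S \<and> matricial_dimension S > 2) \<and>
   \<not> (\<forall>S. numerical_semigroup S \<and> (\<forall>n \<in> nonzero_small_elements S. lonely S n)
          \<longrightarrow> dim2_realizable S)"
proof -
  \<comment> \<open>Sums of two nonzero elements are at least 10, so closure is automatic. Two
    consecutive elements occur only from 9 on, and the small elements 5 and 7 have no neighbours in
    \<open>S\<close>.\<close>
  define S :: "nat set" where "S = {0, 5, 7} \<union> {9..}"
  have "- S \<subseteq> {..8}"
    by (auto simp: S_def)
  then have "finite (- S)"
    by (rule finite_subset) simp
  then have S: "numerical_semigroup S"
    by (auto simp: numerical_semigroup_def S_def)
  have "ppm_avoiding S"
    by (auto simp: ppm_avoiding_def S_def)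
  moreover have dim: "matricial_dimension S > 2"
    by (rule matricial_dimension_gt_2[OF S]) (auto simp: S_def)
  moreover have "frobenius_number S = 8"
    unfolding frobenius_number_def
  proof (rule Greatest_equality)
    show "z \<le> 8" if "z \<notin> int ` S" for z
    proof (rule ccontr)
      assume "\<not> z \<le> 8"
      then have "z = int (nat z)" "nat z \<in> S"
        by (auto simp: S_def)
      then show False
        using that by blast
    qed
  qed (auto simp: S_def)
  then have "\<forall>n\<in>nonzero_small_elements S. lonely S n"
    by (auto simp: nonzero_small_elements_def lonely_def S_def)
  ultimately show ?thesis
    using S by (auto simp: dim2_realizable_def not_le intro!: exI[of _ S])
qed

end
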